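(* Let $m,n\ge0$ be integers and let $0\le i\le n$, $0\le j\le n$ be integers. Then $$\sum_{l=i}^n(-1)^{l-i}\binom{n}{l}\frac{(1/2)_l}{(m+1)_l}\binom{l}{i}=\binom{2n+2m-2i}{2m}\binom{n+m}{n}^{-1}\binom{n+m-i}{m}^{-1}a_{ni},$$ and $$\sum_{l=j}^n\binom{2n+2m-2l}{2m}\binom{n+m-l}{m}^{-1}\binom{l}{j}a_{nl}=\binom{n+m}{n}\binom{n}{j}\frac{(1/2)_j}{(m+1)_j}.$$
   Context: Notation: $(y)_0:=1$, $(y)_k:=y(y+1)\cdots(y+k-1)$ for $k\ge1$; $a_{nj}:=4^{-n}\binom{2j}{j}\binom{2n-2j}{n-j}$ for $0\le j\le n$. *)

theory Defs
  imports Complex_Main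
begin

text \<open>
  The numbers \<open>a\<^sub>n\<^sub>j\<close>. Only arguments with \<open>j \<le> n\<close> are meaningful; beyond that range the
  subtractions on natural numbers truncate.
  The shifted factorial \<open>(y)\<^sub>k\<close> is the library's \<^const>\<open>pochhammer\<close>.
\<close>

definition a_num :: "nat \<Rightarrow> nat \<Rightarrow> real" where
  "a_num n j = real ((2 * j) choose j) * real ((2 * n - 2 * j) choose (n - j)) / 4 ^ n"

end

theory Submission
  imports Defs
begin

text \<open>
  Write \<open>(y)\<^sub>k\<close> for the shifted factorial and \<open>C(n, k)\<close> for the binomial coefficient.
  The duplication formula \<open>(2k)! = 4\<^sup>k (1/2)\<^sub>k k!\<close> turns the binomial coefficients with
  doubled arguments into shifted factorials at \<open>1/2\<close>, and the weight common to both
  identities collapses to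

  \<open>C(2n+2m-2l, 2m) C(n+m-l, m)\<^sup>-\<^sup>1 a\<^sub>n\<^sub>l = C(n, l) (1/2)\<^sub>l (m+1/2)\<^sub>n\<^sub>-\<^sub>l / n!\<close>

  (lemma \<open>weight_eq_pochhammer\<close>). Since moreover \<open>C(n+m, n) = (m+1)\<^sub>n / n!\<close>, both claims
  become statements about shifted factorials only, with \<open>b = 1/2\<close>, \<open>c = m + 1\<close> and
  \<open>d = c - b = m + 1/2\<close>.

  After rewriting \<open>C(n, l) C(l, i) = C(n, i) C(n-i, l-i)\<close> and splitting off the first \<open>i\<close>
  factors of \<open>(b)\<^sub>l\<close> and \<open>(c)\<^sub>l\<close>, the first sum is a terminating hypergeometric series
  \<open>\<^sub>2F\<^sub>1\<close> at \<open>1\<close>; the same rewriting makes the second a convolution of shifted factorials.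
  Both are evaluated by the Chu--Vandermonde identity
  \<open>(a + b)\<^sub>N = \<Sum>\<^sub>k C(N, k) (a)\<^sub>k (b)\<^sub>N\<^sub>-\<^sub>k\<close>, the second directly as
  \<open>pochhammer_binomial_sum\<close>, the first through \<open>sum_alternating_pochhammer_ratio\<close>.
\<close>

text \<open>
  Reading the last \<open>N - k\<close> factors of \<open>(c)\<^sub>N\<close> backwards with opposite signs gives
  \<open>(c)\<^sub>N / (c)\<^sub>k = (-1)\<^sup>N\<^sup>-\<^sup>k (1 - c - N)\<^sub>N\<^sub>-\<^sub>k\<close>. This moves the denominator into the
  numerator and makes the sum a Chu--Vandermonde convolution of \<open>b\<close> with \<open>1 - c - N\<close>;
  one more reversal of the resulting \<open>(b + 1 - c - N)\<^sub>N\<close> produces \<open>(c - b)\<^sub>N\<close>.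
\<close>

lemma sum_alternating_pochhammer_ratio:
  fixes b c :: "'a::field"
  assumes nz: "pochhammer c N \<noteq> 0"
  shows "(\<Sum>k\<le>N. (-1) ^ k * of_nat (N choose k) * (pochhammer b k / pochhammer c k))
           = pochhammer (c - b) N / pochhammer c N"
proof -
  have summand: "pochhammer c N * ((-1) ^ k * of_nat (N choose k) * (pochhammer b k / pochhammer c k))
      = (-1) ^ N * (of_nat (N choose k) * pochhammer b k * pochhammer (1 - c - of_nat N) (N - k))"
    if "k \<le> N" for k
  proof -
    have split: "pochhammer c N = pochhammer c k * pochhammer (c + of_nat k) (N - k)"
      using that by (rule pochhammer_product)
    have "pochhammer (1 - c - of_nat N) (N - k)
        = (-1) ^ (N - k) * pochhammer (c + of_nat k) (N - k)"
      using pochhammer_minus[of "c + of_nat N - 1" "N - k"] that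
      by (simp add: of_nat_diff algebra_simps)
    moreover have "(-1 :: 'a) ^ k = (-1) ^ N * (-1) ^ (N - k)"
      using that by (simp add: minus_one_power_iff)
    moreover have "pochhammer c k \<noteq> 0"
      using nz split by auto
    ultimately show ?thesis
      by (simp add: split field_simps)
  qed
  have reversal: "(-1) ^ N * pochhammer (b + (1 - c - of_nat N)) N = pochhammer (c - b) N"
    using pochhammer_minus[of "c - b + of_nat N - 1" N]
    by (simp add: algebra_simps)
  have "pochhammer c N * (\<Sum>k\<le>N. (-1) ^ k * of_nat (N choose k) * (pochhammer b k / pochhammer c k))
      = pochhammer (c - b) N"
    unfolding sum_distrib_left reversal[symmetric] pochhammer_binomial_sum
    by (intro sum.cong refl summand) simp
  then show ?thesis
    using nz by (simp add: field_simps)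
qed

lemma choose_add_mult_choose:
  assumes "i + k \<le> n"
  shows "(n choose (i + k)) * ((i + k) choose i) = (n choose i) * ((n - i) choose k)"
  using choose_mult[of i "i + k" n] assms by simp

lemma sum_shift_to_zero:
  fixes f :: "nat \<Rightarrow> 'a::comm_monoid_add"
  assumes "i \<le> n"
  shows "(\<Sum>l=i..n. f l) = (\<Sum>k\<le>n - i. f (i + k))"
  using assms sum.atLeastAtMost_shift_0[of i n f] by (simp add: atLeast0AtMost)

text \<open>
  Factoring \<open>(b)\<^sub>i / (c)\<^sub>i\<close> out of the terms replaces \<open>b\<close>, \<open>c\<close> by \<open>b + i\<close>, \<open>c + i\<close>,
  whose difference is still \<open>c - b\<close>.
\<close>

lemma sum_alternating_binomial_pochhammer_ratio:
  fixes b c :: "'a::field"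
  assumes "i \<le> n" and nz: "pochhammer c n \<noteq> 0"
  shows "(\<Sum>l=i..n. (-1) ^ (l - i) * of_nat (n choose l)
              * (pochhammer b l / pochhammer c l) * of_nat (l choose i))
           = of_nat (n choose i) * pochhammer b i * pochhammer (c - b) (n - i) / pochhammer c n"
proof -
  let ?N = "n - i"
  have split: "pochhammer c n = pochhammer c i * pochhammer (c + of_nat i) ?N"
    using \<open>i \<le> n\<close> by (rule pochhammer_product)
  have nz': "pochhammer (c + of_nat i) ?N \<noteq> 0"
    using nz split by auto
  have summand: "(-1) ^ (i + k - i) * of_nat (n choose (i + k))
        * (pochhammer b (i + k) / pochhammer c (i + k)) * of_nat ((i + k) choose i)
      = of_nat (n choose i) * (pochhammer b i / pochhammer c i)
        * ((-1) ^ k * of_nat (?N choose k)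
            * (pochhammer (b + of_nat i) k / pochhammer (c + of_nat i) k))"
    if "k \<le> ?N" for k
  proof -
    have "of_nat (n choose (i + k)) * of_nat ((i + k) choose i)
        = (of_nat (n choose i) * of_nat (?N choose k) :: 'a)"
      using choose_add_mult_choose[of i k n] that \<open>i \<le> n\<close>
      by (simp flip: of_nat_mult)
    then show ?thesis
      by (simp add: pochhammer_product' mult_ac)
  qed
  have "(\<Sum>l=i..n. (-1) ^ (l - i) * of_nat (n choose l)
              * (pochhammer b l / pochhammer c l) * of_nat (l choose i))
      = (\<Sum>k\<le>?N. of_nat (n choose i) * (pochhammer b i / pochhammer c i)
        * ((-1) ^ k * of_nat (?N choose k)
            * (pochhammer (b + of_nat i) k / pochhammer (c + of_nat i) k)))"
    unfolding sum_shift_to_zero[OF \<open>i \<le> n\<close>] by (intro sum.cong refl summand) simp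
  also have "\<dots> = of_nat (n choose i) * (pochhammer b i / pochhammer c i)
        * (pochhammer (c - b) ?N / pochhammer (c + of_nat i) ?N)"
    unfolding sum_distrib_left[symmetric] sum_alternating_pochhammer_ratio[OF nz'] by simp
  finally show ?thesis
    by (simp add: split)
qed

lemma sum_binomial_pochhammer_convolution:
  fixes b d :: "'a::comm_ring_1"
  assumes "j \<le> n"
  shows "(\<Sum>l=j..n. of_nat (l choose j)
              * (of_nat (n choose l) * pochhammer b l * pochhammer d (n - l)))
           = of_nat (n choose j) * pochhammer b j * pochhammer (b + d + of_nat j) (n - j)"
proof -
  let ?N = "n - j"
  have summand: "of_nat ((j + k) choose j)
        * (of_nat (n choose (j + k)) * pochhammer b (j + k) * pochhammer d (n - (j + k)))
      = of_nat (n choose j) * pochhammer b j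
        * (of_nat (?N choose k) * pochhammer (b + of_nat j) k * pochhammer d (?N - k))"
    if "k \<le> ?N" for k
  proof -
    have "of_nat ((j + k) choose j) * of_nat (n choose (j + k))
        = (of_nat (n choose j) * of_nat (?N choose k) :: 'a)"
      using choose_add_mult_choose[of j k n] that \<open>j \<le> n\<close>
      by (simp add: mult.commute flip: of_nat_mult)
    then have "of_nat ((j + k) choose j) * of_nat (n choose (j + k)) * P
        = of_nat (n choose j) * of_nat (?N choose k) * P" for P :: 'a
      by simp
    from this[of "pochhammer b (j + k) * pochhammer d (n - (j + k))"] show ?thesis
      by (simp add: pochhammer_product' mult_ac)
  qed
  have "(\<Sum>l=j..n. of_nat (l choose j)
              * (of_nat (n choose l) * pochhammer b l * pochhammer d (n - l)))
      = (\<Sum>k\<le>?N. of_nat (n choose j) * pochhammer b j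
        * (of_nat (?N choose k) * pochhammer (b + of_nat j) k * pochhammer d (?N - k)))"
    unfolding sum_shift_to_zero[OF \<open>j \<le> n\<close>] by (intro sum.cong refl summand) simp
  also have "\<dots> = of_nat (n choose j) * pochhammer b j * pochhammer (b + of_nat j + d) ?N"
    by (simp add: pochhammer_binomial_sum flip: sum_distrib_left)
  finally show ?thesis
    by (simp add: add_ac)
qed

lemma binomial_eq_pochhammer_over_fact:
  "real ((n + m) choose n) = pochhammer (real m + 1) n / fact n"
  using binomial_gbinomial[of "n + m" n, where ?'a = real]
  by (simp add: gbinomial_pochhammer' add_ac)

lemma central_binomial_eq_pochhammer_half:
  "real ((2 * k) choose k) = 4 ^ k * pochhammer (1/2) k / fact k"
proof -
  have "real ((2 * k) choose k) = fact (2 * k) / (fact k * fact k)"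
    by (subst binomial_fact) (simp_all add: mult_2)
  then show ?thesis
    by (simp add: fact_double power_mult)
qed

text \<open>
  Expanding both binomial coefficients and duplicating \<open>(2N+2m)!\<close>, \<open>(2N)!\<close> and \<open>(2m)!\<close>,
  all powers of \<open>4\<close> and all plain factorials cancel. What is left is
  \<open>(1/2)\<^sub>m\<^sub>+\<^sub>N\<close> over \<open>(1/2)\<^sub>m (1/2)\<^sub>N\<close>.
\<close>

lemma binomial_double_ratio:
  "real ((2 * (N + m)) choose (2 * m)) * inverse (real ((N + m) choose m))
     = pochhammer (real m + 1/2) N / pochhammer (1/2) N"
proof -
  have pos: "pochhammer (1/2 :: real) k \<noteq> 0" for k
    using pochhammer_pos[of "1/2 :: real" k] by simp
  have split: "pochhammer (1/2 :: real) (N + m)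
      = pochhammer (1/2) m * pochhammer (real m + 1/2) N"
    using pochhammer_product'[of "1/2 :: real" m N] by (simp add: add_ac)
  have "real ((2 * (N + m)) choose (2 * m)) = fact (2 * (N + m)) / (fact (2 * m) * fact (2 * N))"
    by (subst binomial_fact) (simp_all flip: diff_mult_distrib2)
  also have "\<dots> = fact (N + m) / (fact m * fact N)
      * (pochhammer (real m + 1/2) N / pochhammer (1/2) N)"
    using pos[of m] pos[of N] unfolding fact_double split
    by (simp add: power_add distrib_left mult_ac)
  also have "fact (N + m) / (fact m * fact N) = real ((N + m) choose m)"
    by (subst binomial_fact) simp_all
  finally show ?thesis
    by simp
qed

text \<open>The factor \<open>(1/2)\<^sub>n\<^sub>-\<^sub>l\<close> in \<open>a\<^sub>n\<^sub>l\<close> cancels the denominator of the binomial ratio.\<close>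

lemma weight_eq_pochhammer:
  assumes "l \<le> n"
  shows "real ((2 * n + 2 * m - 2 * l) choose (2 * m)) * inverse (real ((n + m - l) choose m))
           * a_num n l
         = real (n choose l) * pochhammer (1/2) l * pochhammer (real m + 1/2) (n - l) / fact n"
proof -
  obtain N where n: "n = l + N"
    using assms le_Suc_ex by blast
  have pos: "pochhammer (1/2 :: real) N \<noteq> 0"
    using pochhammer_pos[of "1/2 :: real" N] by simp
  have args: "2 * n + 2 * m - 2 * l = 2 * (N + m)" "n + m - l = N + m" "2 * n - 2 * l = 2 * N"
    by (simp_all add: n)
  have a: "a_num n l = pochhammer (1/2) l * pochhammer (1/2) N / (fact l * fact N)"
    unfolding a_num_def args by (simp add: n central_binomial_eq_pochhammer_half power_add)
  have "real (n choose l) = fact n / (fact l * fact N)"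
    by (simp add: n binomial_fact)
  then show ?thesis
    unfolding args binomial_double_ratio a using pos by (simp add: n field_simps)
qed

theorem corollary2p5:
  fixes m n i j :: nat
  assumes "i \<le> n" and "j \<le> n"
  shows "(\<Sum>l=i..n. (-1) ^ (l - i) * real (n choose l)
              * (pochhammer (1/2) l / pochhammer (real m + 1) l) * real (l choose i))
          = real ((2 * n + 2 * m - 2 * i) choose (2 * m))
              * inverse (real ((n + m) choose n)) * inverse (real ((n + m - i) choose m))
              * a_num n i
       \<and> (\<Sum>l=j..n. real ((2 * n + 2 * m - 2 * l) choose (2 * m))
              * inverse (real ((n + m - l) choose m)) * real (l choose j) * a_num n l)
          = real ((n + m) choose n) * real (n choose j)
              * (pochhammer (1/2) j / pochhammer (real m + 1) j)"
proof
  have nz: "pochhammer (real m + 1) k \<noteq> 0" for k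
    using pochhammer_pos[of "real m + 1" k] by simp
  have "(\<Sum>l=i..n. (-1) ^ (l - i) * real (n choose l)
            * (pochhammer (1/2) l / pochhammer (real m + 1) l) * real (l choose i))
      = real (n choose i) * pochhammer (1/2) i * pochhammer (real m + 1/2) (n - i)
          / pochhammer (real m + 1) n"
    using sum_alternating_binomial_pochhammer_ratio[OF \<open>i \<le> n\<close> nz, of "1/2"]
    by (simp add: add_diff_eq[symmetric])
  also have "\<dots> = inverse (real ((n + m) choose n))
      * (real ((2 * n + 2 * m - 2 * i) choose (2 * m))
          * inverse (real ((n + m - i) choose m)) * a_num n i)"
    unfolding weight_eq_pochhammer[OF \<open>i \<le> n\<close>] binomial_eq_pochhammer_over_fact
    by simp
  finally show "(\<Sum>l=i..n. (-1) ^ (l - i) * real (n choose l)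
              * (pochhammer (1/2) l / pochhammer (real m + 1) l) * real (l choose i))
          = real ((2 * n + 2 * m - 2 * i) choose (2 * m))
              * inverse (real ((n + m) choose n)) * inverse (real ((n + m - i) choose m))
              * a_num n i"
    by (simp add: mult_ac)

  have "(\<Sum>l=j..n. real ((2 * n + 2 * m - 2 * l) choose (2 * m))
            * inverse (real ((n + m - l) choose m)) * real (l choose j) * a_num n l)
      = (\<Sum>l=j..n. real (l choose j)
            * (real (n choose l) * pochhammer (1/2) l * pochhammer (real m + 1/2) (n - l))) / fact n"
    unfolding sum_divide_distrib
  proof (intro sum.cong refl)
    fix l assume "l \<in> {j..n}"
    then show "real ((2 * n + 2 * m - 2 * l) choose (2 * m))
          * inverse (real ((n + m - l) choose m)) * real (l choose j) * a_num n l
        = real (l choose j)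
          * (real (n choose l) * pochhammer (1/2) l * pochhammer (real m + 1/2) (n - l)) / fact n"
      using arg_cong[OF weight_eq_pochhammer[of l n m], of "\<lambda>x. real (l choose j) * x"]
      by (simp add: mult_ac)
  qed
  also have "\<dots> = real (n choose j) * pochhammer (1/2) j
      * pochhammer (real m + 1 + real j) (n - j) / fact n"
    using sum_binomial_pochhammer_convolution[OF \<open>j \<le> n\<close>, of "1/2" "real m + 1/2"]
    by (simp add: add_ac)
  also have "\<dots> = real ((n + m) choose n) * real (n choose j)
      * (pochhammer (1/2) j / pochhammer (real m + 1) j)"
    using pochhammer_product[OF \<open>j \<le> n\<close>, of "real m + 1"] nz[of j]
    by (simp add: binomial_eq_pochhammer_over_fact)
  finally show "(\<Sum>l=j..n. real ((2 * n + 2 * m - 2 * l) choose (2 * m))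
              * inverse (real ((n + m - l) choose m)) * real (l choose j) * a_num n l)
          = real ((n + m) choose n) * real (n choose j)
              * (pochhammer (1/2) j / pochhammer (real m + 1) j)" .
qed

end
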